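(* Let $T=T(q)$ be a finite simple group of Lie type belonging to one of the families listed in the context, and let $\ell$ be its Lie rank, as given there. Let $r$ be a prime dividing $|T|$ but not $q$ (i.e. $r$ is different from the characteristic), and let $R$ be a Sylow $r$-subgroup of $T$. Then $$|R|\le |T|^{2\lfloor \log_r(4(\ell+1)r)\rfloor/\ell}.$$
   Context: $q$ is a prime power, $\log_r$ is the logarithm to base $r$, and $(a,b)$ denotes the gcd. The families, with conditions, Lie rank $\ell$, and orders ($d$ is the number of diagonal outer automorphisms), are as follows; $q$ is any prime power unless stated otherwise. - $\mathrm{A}_n(q)=\mathrm{PSL}(n+1,q)$, $n\ge1$, $(n,q)\notin\{(1,2),(1,3)\}$, $\ell=n$: $d|T|=q^{n(n+1)/2}\prod_{i=2}^{n+1}(q^i-1)$, $d=(n+1,q-1)$. - ${}^2\mathrm{A}_n(q)=\mathrm{PSU}(n+1,q)$ (matrices over $\mathbb F_{q^2}$), $n\ge2$, $(n,q)\ne(2,2)$, $\ell=\lfloor (n+1)/2\rfloor$: $d|T|=q^{n(n+1)/2}\prod_{i=2}^{n+1}(q^i-(-1)^i)$, $d=(n+1,q+1)$. - $\mathrm{B}_n(q)$ (odd-dimensional orthogonal, $\Omega(2n+1,q)$), $n\ge2$, $(n,q)\ne(2,2)$, $\ell=n$; and $\mathrm{C}_n(q)=\mathrm{PSp}(2n,q)$, $n\ge3$, $q$ odd, $\ell=n$: $d|T|=q^{n^2}\prod_{i=1}^n(q^{2i}-1)$, $d=(2,q-1)$. - $\mathrm{D}_n(q)=\mathrm{P}\Omega^+(2n,q)$,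 $n\ge4$, $\ell=n$: $d|T|=q^{n(n-1)}(q^n-1)\prod_{i=1}^{n-1}(q^{2i}-1)$, $d=(4,q^n-1)$. - ${}^2\mathrm{D}_n(q)=\mathrm{P}\Omega^-(2n,q)$, $n\ge4$, $\ell=n-1$: $d|T|=q^{n(n-1)}(q^n+1)\prod_{i=1}^{n-1}(q^{2i}-1)$, $d=(4,q^n+1)$. - ${}^2\mathrm{B}_2(q)$, $q=2^{2m+1}$, $m\ge1$, $\ell=1$: $|T|=q^2(q^2+1)(q-1)$. - ${}^3\mathrm{D}_4(q)$, $\ell=2$: $|T|=q^{12}(q^8+q^4+1)(q^6-1)(q^2-1)$. - $\mathrm{E}_6(q)$, $\ell=6$: $d|T|=q^{36}\prod_{i\in\{2,5,6,8,9,12\}}(q^i-1)$, $d=(3,q-1)$. - ${}^2\mathrm{E}_6(q)$, $\ell=4$: $d|T|=q^{36}(q^{12}-1)(q^9+1)(q^8-1)(q^6-1)(q^5+1)(q^2-1)$, $d=(3,q+1)$. - $\mathrm{E}_7(q)$, $\ell=7$: $d|T|=q^{63}\prod_{i\in\{2,6,8,10,12,14,18\}}(q^i-1)$, $d=(2,q-1)$. - $\mathrm{E}_8(q)$, $\ell=8$: $|T|=q^{120}\prod_{i\in\{2,8,12,14,18,20,24,30\}}(q^i-1)$. - $\mathrm{F}_4(q)$, $\ell=4$: $|T|=q^{24}\prod_{i\in\{2,6,8,12\}}(q^i-1)$. - ${}^2\mathrm{F}_4(q)'$, $q=2^{2m+1}$, $m\ge0$, $\ell=2$: $|T|=q^{12}(q^6+1)(q^4-1)(q^3+1)(q-1)$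 if $q>2$; for $q=2$ it is the Tits group, whose order is half the value of this expression. - $\mathrm{G}_2(q)$, $q\ge3$, $\ell=2$: $|T|=q^6(q^6-1)(q^2-1)$. - ${}^2\mathrm{G}_2(q)$, $q=3^{2m+1}$, $m\ge1$, $\ell=1$: $|T|=q^3(q^3+1)(q-1)$. *)

theory Defs
  imports
    Complex_Main
    "HOL-Library.Cardinality"
    "HOL-Number_Theory.Prime_Powers"
    "HOL-Algebra.Elementary_Groups"
    "HOL-Algebra.Generated_Groups"
    "HOL-Algebra.SimpleGroups"
    "HOL-Algebra.Bij"
    "Jordan_Normal_Form.Determinant"
begin

section \<open>Classical groups\<close>

text \<open>
  The finite field is the type \<open>'k\<close>; its cardinality is prescribed in \<open>lie_type_group\<close> below.
\<close>

definition GL_group :: "nat \<Rightarrow> 'k::field mat monoid" where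
  "GL_group N = \<lparr>carrier = {A \<in> carrier_mat N N. det A \<noteq> 0}, mult = (*), one = 1\<^sub>m N\<rparr>"

definition scalar_mats :: "nat \<Rightarrow> 'k::field mat set" where
  "scalar_mats N = {c \<cdot>\<^sub>m 1\<^sub>m N | c. c \<noteq> 0}"

definition modulo_scalars :: "nat \<Rightarrow> 'k::field mat set \<Rightarrow> 'k mat set monoid" where
  "modulo_scalars N S = (GL_group N)\<lparr>carrier := S\<rparr> Mod (S \<inter> scalar_mats N)"

definition SL_mats :: "nat \<Rightarrow> 'k::field mat set" where
  "SL_mats N = {A \<in> carrier_mat N N. det A = 1}"

definition SU_mats :: "nat \<Rightarrow> nat \<Rightarrow> 'k::field mat set" where
  \<comment> \<open>the field has \<open>q\<^sup>2\<close> elements, so \<open>x \<mapsto> x ^ q\<close> is its involution\<close>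
  "SU_mats N q = {A \<in> carrier_mat N N. det A = 1 \<and> A * (map_mat (\<lambda>x. x ^ q) A)\<^sup>T = 1\<^sub>m N}"

definition Sp_mats :: "nat \<Rightarrow> 'k::field mat set" where
  "Sp_mats n = (let J = four_block_mat (0\<^sub>m n n) (1\<^sub>m n) (- 1\<^sub>m n) (0\<^sub>m n n)
     in {A \<in> carrier_mat (2 * n) (2 * n). A\<^sup>T * J * A = J})"

definition isometries :: "nat \<Rightarrow> ('k::field vec \<Rightarrow> 'k) \<Rightarrow> 'k mat set" where
  "isometries N Q = {A \<in> carrier (GL_group N). \<forall>v \<in> carrier_vec N. Q (A *\<^sub>v v) = Q v}"

text \<open>
  In all dimensions, types and characteristics that occur below, \<open>\<Omega>\<close> is the derived subgroup of
  the full isometry group of the quadratic form.  Quadratic forms (rather than bilinear ones) are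
  used because the field may have characteristic 2.
\<close>

definition Omega_mats :: "nat \<Rightarrow> ('k::field vec \<Rightarrow> 'k) \<Rightarrow> 'k mat set" where
  "Omega_mats N Q = derived (GL_group N) (isometries N Q)"

definition quad_odd :: "nat \<Rightarrow> 'k::field vec \<Rightarrow> 'k" where
  "quad_odd n v = (\<Sum>i<n. v $ i * v $ (n + i)) + (v $ (2 * n))\<^sup>2"

definition quad_plus :: "nat \<Rightarrow> 'k::field vec \<Rightarrow> 'k" where
  "quad_plus n v = (\<Sum>i<n. v $ i * v $ (n + i))"

definition quad_minus :: "nat \<Rightarrow> 'k::field \<Rightarrow> 'k vec \<Rightarrow> 'k" where
  \<comment> \<open>of minus type provided that \<open>X\<^sup>2 + X + z\<close> has no root\<close>
  "quad_minus n z v = (\<Sum>i<n - 1. v $ i * v $ (n - 1 + i))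
     + ((v $ (2 * n - 2))\<^sup>2 + v $ (2 * n - 2) * v $ (2 * n - 1) + z * (v $ (2 * n - 1))\<^sup>2)"


section \<open>Root systems\<close>

text \<open>
  The Dynkin diagrams needed for the exceptional and the twisted exceptional groups.  Nodes are
  numbered as in Bourbaki, but from 0.
\<close>

datatype dynkin = Dyn_B2 | Dyn_D4 | Dyn_E6 | Dyn_E7 | Dyn_E8 | Dyn_F4 | Dyn_G2

fun dyn_rank :: "dynkin \<Rightarrow> nat" where
  "dyn_rank Dyn_B2 = 2"
| "dyn_rank Dyn_D4 = 4"
| "dyn_rank Dyn_E6 = 6"
| "dyn_rank Dyn_E7 = 7"
| "dyn_rank Dyn_E8 = 8"
| "dyn_rank Dyn_F4 = 4"
| "dyn_rank Dyn_G2 = 2"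

fun dyn_edges :: "dynkin \<Rightarrow> (nat \<times> nat) set" where
  "dyn_edges Dyn_B2 = {(0,1)}"
| "dyn_edges Dyn_D4 = {(0,1), (1,2), (1,3)}"
| "dyn_edges Dyn_E6 = {(0,2), (2,3), (3,4), (4,5), (1,3)}"
| "dyn_edges Dyn_E7 = {(0,2), (2,3), (3,4), (4,5), (5,6), (1,3)}"
| "dyn_edges Dyn_E8 = {(0,2), (2,3), (3,4), (4,5), (5,6), (6,7), (1,3)}"
| "dyn_edges Dyn_F4 = {(0,1), (1,2), (2,3)}"
| "dyn_edges Dyn_G2 = {(0,1)}"

text \<open>
  Half the squared length of a simple root, normalised so that short roots get 1.
\<close>

fun half_sq_length :: "dynkin \<Rightarrow> nat \<Rightarrow> int" where
  "half_sq_length Dyn_B2 i = (if i = 0 then 2 else 1)"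
| "half_sq_length Dyn_F4 i = (if i < 2 then 2 else 1)"
| "half_sq_length Dyn_G2 i = (if i = 0 then 1 else 3)"
| "half_sq_length _ i = 1"

definition gram :: "dynkin \<Rightarrow> nat \<Rightarrow> nat \<Rightarrow> int" where
  "gram X i j =
     (if i = j then 2 * half_sq_length X i
      else if (i, j) \<in> dyn_edges X \<or> (j, i) \<in> dyn_edges X
      then - max (half_sq_length X i) (half_sq_length X j) else 0)"

text \<open>
  A root is given by its coefficients with respect to the simple roots (0 from the rank onwards).
\<close>

type_synonym root = "nat \<Rightarrow> int"

definition simple_root :: "nat \<Rightarrow> root" where
  "simple_root i = (\<lambda>j. if j = i then 1 else 0)"

definition root_neg :: "root \<Rightarrow> root" where
  "root_neg r = (\<lambda>i. - r i)"

definition root_add :: "root \<Rightarrow> root \<Rightarrow> root" where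
  "root_add r s = (\<lambda>i. r i + s i)"

definition root_ip :: "dynkin \<Rightarrow> root \<Rightarrow> root \<Rightarrow> int" where
  "root_ip X r s = (\<Sum>i<dyn_rank X. \<Sum>j<dyn_rank X. r i * s j * gram X i j)"

text \<open>All uses of \<open>div\<close> in this section and the next are exact divisions.\<close>

definition cartan_int :: "dynkin \<Rightarrow> root \<Rightarrow> root \<Rightarrow> int" where
  "cartan_int X r s = (2 * root_ip X r s) div root_ip X r r"

inductive_set roots :: "dynkin \<Rightarrow> root set" for X :: dynkin where
  simple: "i < dyn_rank X \<Longrightarrow> simple_root i \<in> roots X"
| reflect: "r \<in> roots X \<Longrightarrow> i < dyn_rank X
    \<Longrightarrow> (\<lambda>j. r j - cartan_int X (simple_root i) r * simple_root i j) \<in> roots X"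

definition pos_roots :: "dynkin \<Rightarrow> root set" where
  "pos_roots X = {r \<in> roots X. \<forall>i. 0 \<le> r i}"


section \<open>Chevalley groups\<close>

text \<open>
  The simple complex Lie algebra of type \<open>X\<close> has a Chevalley basis, consisting of \<open>H i\<close> (the
  coroot of the \<open>i\<close>-th simple root) and the root vectors \<open>E r\<close>:
  \<open>[H i, E r] = A E r\<close> with \<open>A\<close> the Cartan integer, \<open>[E r, E (-r)]\<close> is the coroot of \<open>r\<close>, and
  \<open>[E r, E s] = N r s E (r + s)\<close> with \<open>N r s = \<plusminus>(p + 1)\<close>, where \<open>p\<close> is maximal such that
  \<open>s - p r\<close> is a root.  The signs are not unique, but any two choices for which the Jacobi
  identity holds differ by sign changes of the root vectors.
\<close>

datatype chev_basis = H nat | E root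

definition chev_basis :: "dynkin \<Rightarrow> chev_basis set" where
  "chev_basis X = H ` {..<dyn_rank X} \<union> E ` roots X"

definition unit_coord :: "'b \<Rightarrow> 'b \<Rightarrow> int" where
  "unit_coord b = (\<lambda>c. if c = b then 1 else 0)"

definition coroot_coord :: "dynkin \<Rightarrow> root \<Rightarrow> chev_basis \<Rightarrow> int" where
  "coroot_coord X r b = (case b of
      H i \<Rightarrow> if i < dyn_rank X then (2 * r i * half_sq_length X i) div root_ip X r r else 0
    | E _ \<Rightarrow> 0)"

text \<open>\<open>chev_bracket X N b c d\<close> is the coefficient of \<open>d\<close> in \<open>[b, c]\<close>.\<close>

fun chev_bracket ::
  "dynkin \<Rightarrow> (root \<Rightarrow> root \<Rightarrow> int) \<Rightarrow> chev_basis \<Rightarrow> chev_basis \<Rightarrow> chev_basis \<Rightarrow> int" where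
  "chev_bracket X N (H i) (H j) d = 0"
| "chev_bracket X N (H i) (E r) d = cartan_int X (simple_root i) r * unit_coord (E r) d"
| "chev_bracket X N (E r) (H i) d = - (cartan_int X (simple_root i) r * unit_coord (E r) d)"
| "chev_bracket X N (E r) (E s) d =
     (if s = root_neg r then coroot_coord X r d
      else if root_add r s \<in> roots X then N r s * unit_coord (E (root_add r s)) d
      else 0)"

definition chevalley_constants :: "dynkin \<Rightarrow> (root \<Rightarrow> root \<Rightarrow> int) \<Rightarrow> bool" where
  "chevalley_constants X N \<longleftrightarrow>
     \<comment> \<open>root strings are unbroken, so this cardinality is \<open>p + 1\<close>\<close>
     (\<forall>r \<in> roots X. \<forall>s \<in> roots X. root_add r s \<in> roots X \<longrightarrow>
        \<bar>N r s\<bar> = int (card {k :: nat. (\<lambda>i. s i - int k * r i) \<in> roots X})) \<and>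
     (\<forall>b \<in> chev_basis X. \<forall>c \<in> chev_basis X. \<forall>e.
        chev_bracket X N b c e = - chev_bracket X N c b e) \<and>
     (\<forall>b \<in> chev_basis X. \<forall>c \<in> chev_basis X. \<forall>d \<in> chev_basis X. \<forall>e.
        (\<Sum>f \<in> chev_basis X. chev_bracket X N b c f * chev_bracket X N f d e
           + chev_bracket X N c d f * chev_bracket X N f b e
           + chev_bracket X N d b f * chev_bracket X N f c e) = 0)"

text \<open>\<open>ad_power X N r k c b\<close> is the coefficient of \<open>b\<close> in \<open>(ad (E r)) ^ k\<close> applied to \<open>c\<close>.\<close>

fun ad_power ::
  "dynkin \<Rightarrow> (root \<Rightarrow> root \<Rightarrow> int) \<Rightarrow> root \<Rightarrow> nat \<Rightarrow> chev_basis \<Rightarrow> chev_basis \<Rightarrow> int" where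
  "ad_power X N r 0 c b = unit_coord c b"
| "ad_power X N r (Suc k) c b =
     (\<Sum>d \<in> chev_basis X. ad_power X N r k c d * chev_bracket X N (E r) d b)"

text \<open>
  The root element \<open>x\<^sub>r(t) = exp (t ad (E r))\<close> on the Lie algebra over \<open>'k\<close>, whose elements are
  coordinate functions.  The divided powers \<open>(ad (E r)) ^ k / k!\<close> are integral and vanish for
  \<open>k \<ge> 4\<close>.  Coordinates outside the basis are irrelevant and left unchanged.
\<close>

definition root_elt :: "dynkin \<Rightarrow> (root \<Rightarrow> root \<Rightarrow> int) \<Rightarrow> root \<Rightarrow> 'k::field
    \<Rightarrow> (chev_basis \<Rightarrow> 'k) \<Rightarrow> (chev_basis \<Rightarrow> 'k)" where
  "root_elt X N r t v b =
     (if b \<in> chev_basis X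
      then \<Sum>k<4. t ^ k * (\<Sum>c \<in> chev_basis X. of_int (ad_power X N r k c b div fact k) * v c)
      else v b)"

definition chevalley_group :: "dynkin \<Rightarrow> (root \<Rightarrow> root \<Rightarrow> int)
    \<Rightarrow> ((chev_basis \<Rightarrow> 'k::field) \<Rightarrow> (chev_basis \<Rightarrow> 'k)) monoid" where
  "chevalley_group X N =
     subgroup_generated (BijGroup UNIV) {root_elt X N r t | r t. r \<in> roots X}"


section \<open>Twisted groups\<close>

definition unipotent_pos :: "dynkin \<Rightarrow> (root \<Rightarrow> root \<Rightarrow> int)
    \<Rightarrow> ((chev_basis \<Rightarrow> 'k::field) \<Rightarrow> (chev_basis \<Rightarrow> 'k)) set" where
  "unipotent_pos X N = generate (BijGroup UNIV) {root_elt X N r t | r t. r \<in> pos_roots X}"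

definition unipotent_neg :: "dynkin \<Rightarrow> (root \<Rightarrow> root \<Rightarrow> int)
    \<Rightarrow> ((chev_basis \<Rightarrow> 'k::field) \<Rightarrow> (chev_basis \<Rightarrow> 'k)) set" where
  "unipotent_neg X N =
     generate (BijGroup UNIV) {root_elt X N (root_neg r) t | r t. r \<in> pos_roots X}"

text \<open>
  \<open>\<sigma>\<close> is the product of a graph and a field automorphism:
  \<open>x\<^sub>\<plusminus>\<^sub>\<alpha>(t) \<mapsto> x\<^sub>\<plusminus>\<^sub>\<beta>(t ^ e i)\<close> if \<open>\<alpha>, \<beta>\<close> are the simple roots
  number \<open>i\<close> and \<open>\<pi> i\<close>.  These elements generate the group, so \<open>\<sigma>\<close> is unique.
\<close>

definition twisting_automorphism :: "dynkin \<Rightarrow> (root \<Rightarrow> root \<Rightarrow> int) \<Rightarrow> (nat \<Rightarrow> nat) \<Rightarrow> (nat \<Rightarrow> nat)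
    \<Rightarrow> (((chev_basis \<Rightarrow> 'k::field) \<Rightarrow> (chev_basis \<Rightarrow> 'k))
         \<Rightarrow> ((chev_basis \<Rightarrow> 'k) \<Rightarrow> (chev_basis \<Rightarrow> 'k))) \<Rightarrow> bool" where
  "twisting_automorphism X N \<pi> e \<sigma> \<longleftrightarrow>
     \<sigma> \<in> iso (chevalley_group X N) (chevalley_group X N) \<and>
     (\<forall>i < dyn_rank X. \<forall>t.
        \<sigma> (root_elt X N (simple_root i) t) = root_elt X N (simple_root (\<pi> i)) (t ^ e i) \<and>
        \<sigma> (root_elt X N (root_neg (simple_root i)) t)
          = root_elt X N (root_neg (simple_root (\<pi> i))) (t ^ e i))"

definition twisted_group :: "dynkin \<Rightarrow> (root \<Rightarrow> root \<Rightarrow> int)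
    \<Rightarrow> (((chev_basis \<Rightarrow> 'k::field) \<Rightarrow> (chev_basis \<Rightarrow> 'k))
         \<Rightarrow> ((chev_basis \<Rightarrow> 'k) \<Rightarrow> (chev_basis \<Rightarrow> 'k)))
    \<Rightarrow> ((chev_basis \<Rightarrow> 'k) \<Rightarrow> (chev_basis \<Rightarrow> 'k)) monoid" where
  "twisted_group X N \<sigma> = subgroup_generated (BijGroup UNIV)
     ({u \<in> unipotent_pos X N. \<sigma> u = u} \<union> {v \<in> unipotent_neg X N. \<sigma> v = v})"

definition is_chevalley_group ::
    "'k::field itself \<Rightarrow> dynkin \<Rightarrow> ('a, 'm) monoid_scheme \<Rightarrow> bool" where
  "is_chevalley_group K X T \<longleftrightarrow>
     (\<exists>N. chevalley_constants X N \<and>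
          T \<cong> (chevalley_group X N :: ((chev_basis \<Rightarrow> 'k) \<Rightarrow> (chev_basis \<Rightarrow> 'k)) monoid))"

definition is_twisted_group ::
    "'k::field itself \<Rightarrow> dynkin \<Rightarrow> (nat \<Rightarrow> nat) \<Rightarrow> (nat \<Rightarrow> nat) \<Rightarrow> ('a, 'm) monoid_scheme \<Rightarrow> bool" where
  "is_twisted_group K X \<pi> e T \<longleftrightarrow>
     (\<exists>N (\<sigma> :: ((chev_basis \<Rightarrow> 'k) \<Rightarrow> (chev_basis \<Rightarrow> 'k)) \<Rightarrow> _).
        chevalley_constants X N \<and> twisting_automorphism X N \<pi> e \<sigma> \<and> T \<cong> twisted_group X N \<sigma>)"

definition is_twisted_group_derived ::
    "'k::field itself \<Rightarrow> dynkin \<Rightarrow> (nat \<Rightarrow> nat) \<Rightarrow> (nat \<Rightarrow> nat) \<Rightarrow> ('a, 'm) monoid_scheme \<Rightarrow> bool" where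
  "is_twisted_group_derived K X \<pi> e T \<longleftrightarrow>
     (\<exists>N (\<sigma> :: ((chev_basis \<Rightarrow> 'k) \<Rightarrow> (chev_basis \<Rightarrow> 'k)) \<Rightarrow> _).
        chevalley_constants X N \<and> twisting_automorphism X N \<pi> e \<sigma> \<and>
        T \<cong> (twisted_group X N \<sigma>)
              \<lparr>carrier := derived (twisted_group X N \<sigma>) (carrier (twisted_group X N \<sigma>))\<rparr>)"

fun graph_symmetry :: "dynkin \<Rightarrow> nat \<Rightarrow> nat" where
  "graph_symmetry Dyn_B2 i = 1 - i"
| "graph_symmetry Dyn_G2 i = 1 - i"
| "graph_symmetry Dyn_F4 i = 3 - i"
| "graph_symmetry Dyn_D4 i = (if i = 0 then 2 else if i = 2 then 3 else if i = 3 then 0 else i)"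
| "graph_symmetry Dyn_E6 i =
     (if i = 0 then 5 else if i = 5 then 0 else if i = 2 then 4 else if i = 4 then 2 else i)"
| "graph_symmetry _ i = i"

text \<open>
  Suzuki and Ree groups over the field with \<open>p ^ (2 m + 1)\<close> elements: the field automorphism is
  \<open>t \<mapsto> t ^ (p ^ m)\<close>, and the exceptional graph automorphism contributes an additional \<open>p\<close>-th
  power on short simple roots.
\<close>

definition suzuki_ree_exponent :: "dynkin \<Rightarrow> nat \<Rightarrow> nat \<Rightarrow> nat \<Rightarrow> nat" where
  "suzuki_ree_exponent X p m i = (if half_sq_length X i = 1 then p * p ^ m else p ^ m)"


section \<open>The families of simple groups of Lie type\<close>

datatype lie_family =
    Lie_A nat | Lie_2A nat | Lie_B nat | Lie_C nat | Lie_D nat | Lie_2D nat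
  | Lie_2B2 | Lie_3D4 | Lie_E6 | Lie_2E6 | Lie_E7 | Lie_E8 | Lie_F4 | Lie_2F4 | Lie_G2 | Lie_2G2

fun family_condition :: "lie_family \<Rightarrow> nat \<Rightarrow> bool" where
  "family_condition (Lie_A n) q \<longleftrightarrow> 1 \<le> n \<and> (n, q) \<notin> {(1, 2), (1, 3)}"
| "family_condition (Lie_2A n) q \<longleftrightarrow> 2 \<le> n \<and> (n, q) \<noteq> (2, 2)"
| "family_condition (Lie_B n) q \<longleftrightarrow> 2 \<le> n \<and> (n, q) \<noteq> (2, 2)"
| "family_condition (Lie_C n) q \<longleftrightarrow> 3 \<le> n \<and> odd q"
| "family_condition (Lie_D n) q \<longleftrightarrow> 4 \<le> n"
| "family_condition (Lie_2D n) q \<longleftrightarrow> 4 \<le> n"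
| "family_condition Lie_2B2 q \<longleftrightarrow> (\<exists>m\<ge>1. q = 2 ^ (2 * m + 1))"
| "family_condition Lie_2F4 q \<longleftrightarrow> (\<exists>m. q = 2 ^ (2 * m + 1))"
| "family_condition Lie_G2 q \<longleftrightarrow> 3 \<le> q"
| "family_condition Lie_2G2 q \<longleftrightarrow> (\<exists>m\<ge>1. q = 3 ^ (2 * m + 1))"
| "family_condition _ q \<longleftrightarrow> True"

fun lie_rank :: "lie_family \<Rightarrow> nat" where
  "lie_rank (Lie_A n) = n"
| "lie_rank (Lie_2A n) = (n + 1) div 2"
| "lie_rank (Lie_B n) = n"
| "lie_rank (Lie_C n) = n"
| "lie_rank (Lie_D n) = n"
| "lie_rank (Lie_2D n) = n - 1"
| "lie_rank Lie_2B2 = 1"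
| "lie_rank Lie_3D4 = 2"
| "lie_rank Lie_E6 = 6"
| "lie_rank Lie_2E6 = 4"
| "lie_rank Lie_E7 = 7"
| "lie_rank Lie_E8 = 8"
| "lie_rank Lie_F4 = 4"
| "lie_rank Lie_2F4 = 2"
| "lie_rank Lie_G2 = 2"
| "lie_rank Lie_2G2 = 1"

fun lie_type_group ::
    "'k::{field,finite} itself \<Rightarrow> lie_family \<Rightarrow> nat \<Rightarrow> ('a, 'm) monoid_scheme \<Rightarrow> bool" where
  "lie_type_group K (Lie_A n) q T \<longleftrightarrow> CARD('k) = q \<and>
     T \<cong> modulo_scalars (n + 1) (SL_mats (n + 1) :: 'k mat set)"
| "lie_type_group K (Lie_2A n) q T \<longleftrightarrow> CARD('k) = q ^ 2 \<and>
     T \<cong> modulo_scalars (n + 1) (SU_mats (n + 1) q :: 'k mat set)"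
| "lie_type_group K (Lie_B n) q T \<longleftrightarrow> CARD('k) = q \<and>
     T \<cong> (GL_group (2 * n + 1))
           \<lparr>carrier := Omega_mats (2 * n + 1) (quad_odd n :: 'k vec \<Rightarrow> 'k)\<rparr>"
| "lie_type_group K (Lie_C n) q T \<longleftrightarrow> CARD('k) = q \<and>
     T \<cong> modulo_scalars (2 * n) (Sp_mats n :: 'k mat set)"
| "lie_type_group K (Lie_D n) q T \<longleftrightarrow> CARD('k) = q \<and>
     T \<cong> modulo_scalars (2 * n) (Omega_mats (2 * n) (quad_plus n :: 'k vec \<Rightarrow> 'k))"
| "lie_type_group K (Lie_2D n) q T \<longleftrightarrow> CARD('k) = q \<and>
     (\<exists>z :: 'k. (\<forall>t. t\<^sup>2 + t + z \<noteq> 0) \<and>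
        T \<cong> modulo_scalars (2 * n) (Omega_mats (2 * n) (quad_minus n z)))"
| "lie_type_group K Lie_2B2 q T \<longleftrightarrow> CARD('k) = q \<and>
     (\<exists>m. q = 2 ^ (2 * m + 1) \<and>
        is_twisted_group K Dyn_B2 (graph_symmetry Dyn_B2) (suzuki_ree_exponent Dyn_B2 2 m) T)"
| "lie_type_group K Lie_3D4 q T \<longleftrightarrow> CARD('k) = q ^ 3 \<and>
     is_twisted_group K Dyn_D4 (graph_symmetry Dyn_D4) (\<lambda>_. q) T"
| "lie_type_group K Lie_E6 q T \<longleftrightarrow> CARD('k) = q \<and> is_chevalley_group K Dyn_E6 T"
| "lie_type_group K Lie_2E6 q T \<longleftrightarrow> CARD('k) = q ^ 2 \<and>
     is_twisted_group K Dyn_E6 (graph_symmetry Dyn_E6) (\<lambda>_. q) T"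
| "lie_type_group K Lie_E7 q T \<longleftrightarrow> CARD('k) = q \<and> is_chevalley_group K Dyn_E7 T"
| "lie_type_group K Lie_E8 q T \<longleftrightarrow> CARD('k) = q \<and> is_chevalley_group K Dyn_E8 T"
| "lie_type_group K Lie_F4 q T \<longleftrightarrow> CARD('k) = q \<and> is_chevalley_group K Dyn_F4 T"
| "lie_type_group K Lie_2F4 q T \<longleftrightarrow> CARD('k) = q \<and>
     (\<exists>m. q = 2 ^ (2 * m + 1) \<and>
        is_twisted_group_derived K Dyn_F4 (graph_symmetry Dyn_F4) (suzuki_ree_exponent Dyn_F4 2 m) T)"
| "lie_type_group K Lie_G2 q T \<longleftrightarrow> CARD('k) = q \<and> is_chevalley_group K Dyn_G2 T"
| "lie_type_group K Lie_2G2 q T \<longleftrightarrow> CARD('k) = q \<and>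
     (\<exists>m. q = 3 ^ (2 * m + 1) \<and>
        is_twisted_group K Dyn_G2 (graph_symmetry Dyn_G2) (suzuki_ree_exponent Dyn_G2 3 m) T)"

text \<open>
  The order table: \<open>lie_diag F q\<close> is the number \<open>d\<close> of diagonal outer automorphisms and
  \<open>lie_order_times_diag F q\<close> is the tabulated value of \<open>d |T|\<close>.  That the groups above have
  these orders is classical; it is not derived here, but stated as a hypothesis where it is used.
\<close>

fun lie_diag :: "lie_family \<Rightarrow> nat \<Rightarrow> nat" where
  "lie_diag (Lie_A n) q = gcd (n + 1) (q - 1)"
| "lie_diag (Lie_2A n) q = gcd (n + 1) (q + 1)"
| "lie_diag (Lie_B n) q = gcd 2 (q - 1)"
| "lie_diag (Lie_C n) q = gcd 2 (q - 1)"
| "lie_diag (Lie_D n) q = gcd 4 (q ^ n - 1)"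
| "lie_diag (Lie_2D n) q = gcd 4 (q ^ n + 1)"
| "lie_diag Lie_E6 q = gcd 3 (q - 1)"
| "lie_diag Lie_2E6 q = gcd 3 (q + 1)"
| "lie_diag Lie_E7 q = gcd 2 (q - 1)"
| "lie_diag _ q = 1"

fun lie_order_times_diag :: "lie_family \<Rightarrow> int \<Rightarrow> int" where
  "lie_order_times_diag (Lie_A n) q = q ^ (n * (n + 1) div 2) * (\<Prod>i=2..n + 1. q ^ i - 1)"
| "lie_order_times_diag (Lie_2A n) q =
     q ^ (n * (n + 1) div 2) * (\<Prod>i=2..n + 1. q ^ i - (- 1) ^ i)"
| "lie_order_times_diag (Lie_B n) q = q ^ (n ^ 2) * (\<Prod>i=1..n. q ^ (2 * i) - 1)"
| "lie_order_times_diag (Lie_C n) q = q ^ (n ^ 2) * (\<Prod>i=1..n. q ^ (2 * i) - 1)"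
| "lie_order_times_diag (Lie_D n) q =
     q ^ (n * (n - 1)) * (q ^ n - 1) * (\<Prod>i=1..n - 1. q ^ (2 * i) - 1)"
| "lie_order_times_diag (Lie_2D n) q =
     q ^ (n * (n - 1)) * (q ^ n + 1) * (\<Prod>i=1..n - 1. q ^ (2 * i) - 1)"
| "lie_order_times_diag Lie_2B2 q = q ^ 2 * (q ^ 2 + 1) * (q - 1)"
| "lie_order_times_diag Lie_3D4 q = q ^ 12 * (q ^ 8 + q ^ 4 + 1) * (q ^ 6 - 1) * (q ^ 2 - 1)"
| "lie_order_times_diag Lie_E6 q = q ^ 36 * (\<Prod>i\<in>{2, 5, 6, 8, 9, 12}. q ^ i - 1)"
| "lie_order_times_diag Lie_2E6 q =
     q ^ 36 * (q ^ 12 - 1) * (q ^ 9 + 1) * (q ^ 8 - 1) * (q ^ 6 - 1) * (q ^ 5 + 1) * (q ^ 2 - 1)"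
| "lie_order_times_diag Lie_E7 q = q ^ 63 * (\<Prod>i\<in>{2, 6, 8, 10, 12, 14, 18}. q ^ i - 1)"
| "lie_order_times_diag Lie_E8 q = q ^ 120 * (\<Prod>i\<in>{2, 8, 12, 14, 18, 20, 24, 30}. q ^ i - 1)"
| "lie_order_times_diag Lie_F4 q = q ^ 24 * (\<Prod>i\<in>{2, 6, 8, 12}. q ^ i - 1)"
| "lie_order_times_diag Lie_2F4 q =
     (let N = q ^ 12 * (q ^ 6 + 1) * (q ^ 4 - 1) * (q ^ 3 + 1) * (q - 1)
      in if q = 2 then N div 2 else N)"
| "lie_order_times_diag Lie_G2 q = q ^ 6 * (q ^ 6 - 1) * (q ^ 2 - 1)"
| "lie_order_times_diag Lie_2G2 q = q ^ 3 * (q ^ 3 + 1) * (q - 1)"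

definition sylow_subgroup :: "nat \<Rightarrow> 'a set \<Rightarrow> ('a, 'm) monoid_scheme \<Rightarrow> bool" where
  "sylow_subgroup r R T \<longleftrightarrow> subgroup R T \<and> card R = r ^ multiplicity r (Coset.order T)"

end

theory Submission
  imports Defs "HOL-Number_Theory.Pocklington"
begin

text \<open>
  The group enters only through its order, given by the order formula, so this is a statement
  about the \<open>r\<close>-part of an explicit product.  Let \<open>k\<close> be the logarithm in the exponent
  \<open>2 k / \<ell>\<close>.  Of its size only \<open>k \<ge> 1\<close>, and \<open>k \<ge> 2\<close> for \<open>r = 2\<close>, is used.

  If \<open>\<ell> \<le> 2\<close>, the exponent is at least 1 and there is nothing to prove beyond
  \<open>|R| \<le> |T|\<close>.  Otherwise two estimates by powers of \<open>q\<close> are compared.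

  \<^item> \<open>|T|\<close> is at least \<open>q\<close> to the number of roots of the underlying root system: half of them come
    from the power of \<open>q\<close> in the order formula, the other half from
    \<open>q ^ i - 1 \<ge> (q - 1) q ^ (i - 1)\<close>, and the factors \<open>q - 1\<close> (for
    \<open>\<^sup>2A\<^sub>n\<close> and \<open>\<^sup>2E\<^sub>6\<close> rather a factor \<open>q + 1\<close> or \<open>q\<^sup>2 - 1\<close>) absorb the denominator \<open>d\<close>.

  \<^item> The part of the order prime to \<open>q\<close> divides a product of numbers \<open>Q ^ i - 1\<close> with
    \<open>1 \<le> i \<le> m\<close>, where \<open>Q\<close> is \<open>q\<close> or \<open>q\<^sup>2\<close>.  A power of \<open>r\<close> dividing this product is at
    most \<open>(2 Q) ^ m\<close> (lemma \<open>prime_power_dvd_prod_le\<close>), by lifting the exponent and Legendre's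
    bound for the \<open>r\<close>-part of a factorial.  For \<open>r = 2\<close> this requires \<open>Q \<equiv> 1\<close> modulo 4, which
    holds for \<open>Q = q\<^sup>2\<close>.

  For an untwisted group with Coxeter number \<open>h\<close> the number of roots is \<open>\<ell> h\<close>, so
  \<open>|T| ^ (2 / \<ell>) \<ge> q ^ (2 h)\<close>.  In types A and \<open>E\<^sub>6\<close> one takes \<open>Q = q\<close> and \<open>m = h\<close>, so
  that \<open>|R| \<le> (2 q) ^ h \<le> q ^ (2 h)\<close> for odd \<open>r\<close>; for \<open>r = 2\<close> one takes \<open>Q = q\<^sup>2\<close> and uses
  \<open>k \<ge> 2\<close>.  For the other groups \<open>Q = q\<^sup>2\<close> gives \<open>|R| \<le> q ^ (3 m)\<close>, where \<open>m\<close> is \<open>n\<close> in types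
  B, C, D and \<open>\<^sup>2D\<close>, \<open>n + 1\<close> in type \<open>\<^sup>2A\<^sub>n\<close>, and 6, 9, 9, 15 in types \<open>F\<^sub>4\<close>,
  \<open>\<^sup>2E\<^sub>6\<close>, \<open>E\<^sub>7\<close>, \<open>E\<^sub>8\<close>, and this is enough even for \<open>k = 1\<close>; the twisted groups gain
  from \<open>\<ell>\<close> being smaller than the rank of the root system.
\<close>

section \<open>The prime \<open>r\<close> in products of numbers \<open>q ^ i - 1\<close>\<close>

lemma cong_geometric_sum:
  fixes x m :: int
  assumes "m dvd x - 1"
  shows "[(\<Sum>j<n. x ^ j) = int n] (mod m)"
proof -
  have "[x = 1] (mod m)"
    using assms by (simp add: cong_iff_dvd_diff)
  then have "[x ^ j = 1] (mod m)" for j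
    using cong_pow[of x 1 m j] by simp
  then have "[(\<Sum>j<n. x ^ j) = (\<Sum>j<n. 1)] (mod m)"
    by (intro cong_sum) auto
  then show ?thesis by simp
qed

text \<open>
  For odd \<open>r\<close>, writing \<open>y = 1 + r t\<close> gives \<open>y ^ j \<equiv> 1 + j r t\<close> modulo \<open>r\<^sup>2\<close>, so
  the sum is congruent to \<open>r + r t (0 + \<dots> + (r - 1))\<close>, whose second term is divisible by
  \<open>r\<^sup>2\<close>.  For \<open>r = 2\<close> the sum is \<open>1 + y\<close>, which is 2 modulo 4.
\<close>

lemma square_not_dvd_geometric_sum:
  fixes y :: int
  assumes r: "prime r" and y: "int r dvd y - 1" and two: "r = 2 \<Longrightarrow> 4 dvd y - 1"
  shows "\<not> int r ^ 2 dvd (\<Sum>j<r. y ^ j)"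
proof (cases "r = 2")
  case True
  obtain s where "y - 1 = 4 * s" using two[OF True] by (elim dvdE)
  then have "y = 4 * s + 1" by simp
  moreover have "(\<Sum>j<r. y ^ j) = 1 + y" using True by (simp add: numeral_2_eq_2)
  ultimately show ?thesis using True by simp presburger
next
  case False
  then have "odd r" using r primes_dvd_imp_eq two_is_prime_nat by blast
  then obtain c where c: "r = 2 * c + 1" by (elim oddE)
  obtain t where "y - 1 = int r * t" using y by (elim dvdE)
  then have t: "y = 1 + int r * t" by simp
  have pow: "[y ^ j = 1 + int j * (int r * t)] (mod int r ^ 2)" for j
  proof (induction j)
    case (Suc j)
    have "[y ^ Suc j = (1 + int r * t) * (1 + int j * (int r * t))] (mod int r ^ 2)"
      using cong_mult[OF cong_refl[of y "int r ^ 2"] Suc.IH] by (simp add: t)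
    also have "(1 + int r * t) * (1 + int j * (int r * t))
        = (1 + int (Suc j) * (int r * t)) + int r ^ 2 * (int j * t ^ 2)"
      by (simp add: algebra_simps power2_eq_square)
    also have "[\<dots> = 1 + int (Suc j) * (int r * t)] (mod int r ^ 2)"
      by (simp add: cong_iff_dvd_diff)
    finally show ?case .
  qed simp
  have gauss: "(\<Sum>j<r. int j) = int r * int c"
  proof -
    have "2 * (\<Sum>j<n. int j) = int n * (int n - 1)" for n
      by (induction n) (simp_all add: algebra_simps)
    from this[of r] show ?thesis using c by simp
  qed
  have "[(\<Sum>j<r. y ^ j) = (\<Sum>j<r. 1 + int j * (int r * t))] (mod int r ^ 2)"
    by (intro cong_sum pow)
  also have "(\<Sum>j<r. 1 + int j * (int r * t)) = int r + (\<Sum>j<r. int j) * (int r * t)"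
    by (simp add: sum.distrib sum_distrib_right)
  also have "\<dots> = int r + int r ^ 2 * (int c * t)"
    by (simp add: gauss power2_eq_square algebra_simps)
  also have "[\<dots> = int r] (mod int r ^ 2)"
    by (simp add: cong_iff_dvd_diff)
  finally have "int r ^ 2 dvd (\<Sum>j<r. y ^ j) \<longleftrightarrow> int r ^ 2 dvd int r"
    by (rule cong_dvd_iff)
  moreover have "\<not> int r ^ 2 dvd int r"
    using prime_gt_1_nat[OF r] by (auto dest!: zdvd_imp_le simp: power2_eq_square)
  ultimately show ?thesis by simp
qed

text \<open>
  One half of the "lifting the exponent" lemma (in fact equality holds).  A factor \<open>r\<close> of \<open>n\<close>
  is split off by writing \<open>x ^ n - 1 = (y - 1) (1 + y + \<dots> + y ^ (r - 1))\<close> with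
  \<open>y = x ^ (n div r)\<close>, where the second factor contributes at most one to the multiplicity.
\<close>

lemma multiplicity_power_minus_one_le:
  fixes x :: int
  assumes r: "prime r" and x: "int r dvd x - 1" "x > 1" and two: "r = 2 \<Longrightarrow> 4 dvd x - 1"
    and "n > 0"
  shows "multiplicity (int r) (x ^ n - 1) \<le> multiplicity (int r) (x - 1) + multiplicity r n"
  using \<open>n > 0\<close>
proof (induction n rule: less_induct)
  case (less n)
  have p: "prime_elem (int r)" using r by simp
  have pos: "x ^ k - 1 \<noteq> 0" if "k > 0" for k
    using one_less_power[OF x(2) that] by simp
  show ?case
  proof (cases "r dvd n")
    case False
    have "\<not> int r dvd (\<Sum>j<n. x ^ j)"
      using cong_dvd_iff[OF cong_geometric_sum[OF x(1), of n]] False by simp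
    then show ?thesis
      using pos[OF less.prems] pos[of 1]
      by (simp add: power_diff_1_eq prime_elem_multiplicity_mult_distrib[OF p]
          not_dvd_imp_multiplicity_0)
  next
    case True
    then obtain m where m: "n = m * r" by (metis dvdE mult.commute)
    with less.prems have "m > 0" by simp
    define y where "y = x ^ m"
    have *: "d dvd y - 1" if "d dvd x - 1" for d
      using that unfolding y_def power_diff_1_eq by (rule dvd_mult2)
    have y: "int r dvd y - 1" "r = 2 \<Longrightarrow> 4 dvd y - 1"
      using * x(1) two by auto
    let ?G = "\<Sum>j<r. y ^ j"
    have eq: "x ^ n - 1 = (y - 1) * ?G"
      using power_diff_1_eq[of y r] by (simp add: y_def m power_mult)
    have "\<not> multiplicity (int r) ?G \<ge> 2"
      using square_not_dvd_geometric_sum[OF r y] multiplicity_dvd' by blast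
    moreover have "multiplicity (int r) (x ^ n - 1)
        = multiplicity (int r) (y - 1) + multiplicity (int r) ?G"
      using pos[OF less.prems] unfolding eq
      by (intro prime_elem_multiplicity_mult_distrib[OF p]) auto
    moreover have "multiplicity (int r) (y - 1)
        \<le> multiplicity (int r) (x - 1) + multiplicity r m"
      unfolding y_def using less.IH[of m] \<open>m > 0\<close> prime_gt_1_nat[OF r] m by simp
    moreover have "multiplicity r n = multiplicity r m + 1"
      using \<open>m > 0\<close> r by (simp add: m prime_elem_multiplicity_mult_distrib prime_gt_0_nat)
    ultimately show ?thesis by linarith
  qed
qed

lemma sum_multiples:
  fixes f :: "nat \<Rightarrow> nat"
  assumes "e > 0" and "\<And>i. \<not> e dvd i \<Longrightarrow> f i = 0"
  shows "(\<Sum>i=1..n. f i) = (\<Sum>j=1..n div e. f (e * j))"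
proof -
  have "(\<Sum>j=1..n div e. f (e * j)) = (\<Sum>i\<in>(*) e ` {1..n div e}. f i)"
    using assms(1) by (subst sum.reindex) (auto simp: inj_on_def)
  also have "\<dots> = (\<Sum>i=1..n. f i)"
  proof (rule sum.mono_neutral_left)
    show "(*) e ` {1..n div e} \<subseteq> {1..n}"
      using assms(1) by (auto simp: less_eq_div_iff_mult_less_eq mult.commute)
    have "i \<in> (*) e ` {1..n div e}" if "i \<in> {1..n}" "e dvd i" for i
    proof -
      from that(2) obtain j where "i = e * j" by (elim dvdE)
      with that assms(1) show ?thesis
        by (auto simp: less_eq_div_iff_mult_less_eq mult.commute intro!: imageI)
    qed
    then show "\<forall>i\<in>{1..n} - (*) e ` {1..n div e}. f i = 0"
      using assms(2) by blast
  qed simp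
  finally show ?thesis by simp
qed

text \<open>
  Legendre's bound: the sum is the exponent of \<open>r\<close> in \<open>n!\<close>.
\<close>

lemma sum_multiplicity_le:
  fixes r n :: nat
  assumes r: "prime r"
  shows "(r - 1) * (\<Sum>j=1..n. multiplicity r j) \<le> n"
proof (induction n rule: less_induct)
  case (less n)
  show ?case
  proof (cases "n = 0")
    case False
    let ?m = "n div r"
    have r1: "r > 1" using r by (rule prime_gt_1_nat)
    have "(\<Sum>j=1..n. multiplicity r j) = (\<Sum>j=1..?m. multiplicity r (r * j))"
      using r1 by (intro sum_multiples) (auto simp: not_dvd_imp_multiplicity_0)
    also have "\<dots> = (\<Sum>j=1..?m. multiplicity r j + 1)"
      using r by (intro sum.cong) (auto simp: prime_elem_multiplicity_mult_distrib prime_gt_0_nat)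
    also have "\<dots> = (\<Sum>j=1..?m. multiplicity r j) + ?m"
      by (simp add: sum.distrib del: One_nat_def)
    finally have "(r - 1) * (\<Sum>j=1..n. multiplicity r j)
        = (r - 1) * (\<Sum>j=1..?m. multiplicity r j) + (r - 1) * ?m"
      by (simp only: distrib_left)
    also have "\<dots> \<le> ?m + (r - 1) * ?m"
      using less.IH[of ?m] False r1 by simp
    also have "\<dots> = r * ?m" using r1 by (cases r) auto
    also have "\<dots> \<le> n" by simp
    finally show ?thesis .
  qed simp
qed

text \<open>
  The \<open>r\<close>-part of \<open>n!\<close> is at most \<open>2 ^ n\<close>.
\<close>

lemma power_sum_multiplicity_le:
  fixes r n :: nat
  assumes "prime r"
  shows "r ^ (\<Sum>j=1..n. multiplicity r j) \<le> 2 ^ n"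
proof -
  have "r - 1 < 2 ^ (r - 1)" by (rule less_exp)
  then have "r \<le> 2 ^ (r - 1)" by linarith
  then have "r ^ (\<Sum>j=1..n. multiplicity r j) \<le> (2 ^ (r - 1)) ^ (\<Sum>j=1..n. multiplicity r j)"
    by (intro power_mono) auto
  also have "\<dots> \<le> 2 ^ n"
    unfolding power_mult[symmetric] by (intro power_increasing sum_multiplicity_le assms) auto
  finally show ?thesis .
qed

text \<open>
  The key estimate.  Let \<open>e\<close> be the order of \<open>q\<close> modulo \<open>r\<close>, and \<open>k = m div e\<close>.  Only the
  factors with \<open>i = e j\<close>, \<open>j \<le> k\<close>, are divisible by \<open>r\<close>, and the \<open>r\<close>-part of such a
  factor is at most the \<open>r\<close>-part of \<open>q ^ e - 1\<close> times that of \<open>j\<close>.  Hence the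
  \<open>r\<close>-part of the product is at most \<open>(q ^ e) ^ k * 2 ^ k\<close>.  The extra hypothesis for
  \<open>r = 2\<close> is the one under which the exponent lifts.
\<close>

lemma prime_power_dvd_prod_le:
  fixes q r a m :: nat
  assumes r: "prime r" "\<not> r dvd q" and two: "r = 2 \<Longrightarrow> 4 dvd int q - 1" and q: "q \<ge> 2"
    and dvd: "int r ^ a dvd (\<Prod>i=1..m. int q ^ i - 1)"
  shows "r ^ a \<le> (2 * q) ^ m"
proof -
  define e where "e = ord r q"
  define x where "x = int q ^ e"
  define k where "k = m div e"
  define v where "v = multiplicity (int r) (x - 1)"
  have p: "prime_elem (int r)" using r by simp
  have "e > 0"
    using r by (simp add: e_def prime_imp_coprime)
  have e: "int r dvd int q ^ i - 1 \<longleftrightarrow> e dvd i" for i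
  proof -
    have "int r dvd int q ^ i - 1 \<longleftrightarrow> [int (q ^ i) = int 1] (mod int r)"
      by (simp add: cong_iff_dvd_diff)
    also have "\<dots> \<longleftrightarrow> e dvd i"
      unfolding cong_int_iff e_def by (rule ord_divides)
    finally show ?thesis .
  qed
  have pos: "int q ^ i - 1 > 0" if "i > 0" for i
    using one_less_power[of "int q" i] that q by simp
  have nz: "0 \<notin> (\<lambda>i. int q ^ i - 1) ` {1..m}"
  proof
    assume "0 \<in> (\<lambda>i. int q ^ i - 1) ` {1..m}"
    then obtain i where "i \<ge> 1" "int q ^ i - 1 = 0" by auto
    with pos[of i] show False by simp
  qed
  have x: "int r dvd x - 1" "x > 1"
    using e[of e] pos[OF \<open>e > 0\<close>] by (simp_all add: x_def)
  have x4: "4 dvd x - 1" if "r = 2"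
    using two[OF that] unfolding x_def power_diff_1_eq by (rule dvd_mult2)
  have "(\<Prod>i=1..m. int q ^ i - 1) > 0"
    using pos by (intro prod_pos) auto
  then have "a \<le> multiplicity (int r) (\<Prod>i=1..m. int q ^ i - 1)"
    using dvd prime_elem_not_unit[OF p] by (intro multiplicity_geI) (linarith | assumption)+
  also have "\<dots> = (\<Sum>i=1..m. multiplicity (int r) (int q ^ i - 1))"
    using nz by (intro prime_elem_multiplicity_prod_distrib p) auto
  also have "\<dots> = (\<Sum>j=1..k. multiplicity (int r) (int q ^ (e * j) - 1))"
    unfolding k_def using \<open>e > 0\<close> e
    by (intro sum_multiples) (auto simp: not_dvd_imp_multiplicity_0)
  also have "\<dots> \<le> (\<Sum>j=1..k. v + multiplicity r j)"
    unfolding v_def power_mult x_def[symmetric]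
    by (intro sum_mono multiplicity_power_minus_one_le r x x4) auto
  also have "\<dots> = v * k + (\<Sum>j=1..k. multiplicity r j)"
    by (simp add: sum.distrib del: One_nat_def)
  finally have "r ^ a \<le> r ^ (v * k + (\<Sum>j=1..k. multiplicity r j))"
    using prime_gt_0_nat[OF r(1)] by (intro power_increasing) auto
  also have "\<dots> = (r ^ v) ^ k * r ^ (\<Sum>j=1..k. multiplicity r j)"
    by (simp only: power_add power_mult)
  also have "\<dots> \<le> (q ^ e) ^ k * 2 ^ k"
  proof (intro mult_mono power_mono power_sum_multiplicity_le r)
    have "int r ^ v \<le> x - 1"
      using x(2) by (intro zdvd_imp_le) (auto simp: v_def multiplicity_dvd)
    then have "int (r ^ v) \<le> int (q ^ e)" by (simp add: x_def)
    then show "r ^ v \<le> q ^ e" by (simp only: of_nat_le_iff)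
  qed auto
  also have "\<dots> = q ^ (e * k) * 2 ^ k" by (simp add: power_mult)
  also have "\<dots> \<le> q ^ m * 2 ^ m"
    using q by (intro mult_mono power_increasing) (auto simp: k_def intro: div_le_dividend)
  also have "\<dots> = (2 * q) ^ m" by (simp add: power_mult_distrib mult.commute)
  finally show ?thesis .
qed

lemma prime_power_dvd_cofactor:
  fixes q r a b :: nat and X Y :: int
  assumes r: "prime r" "\<not> r dvd q" and dvd: "int r ^ a dvd int q ^ b * X" and "X dvd Y"
  shows "int r ^ a dvd Y"
proof -
  have "coprime (r ^ a) (q ^ b)"
    using prime_imp_coprime[OF r] by simp
  then have "coprime (int (r ^ a)) (int (q ^ b))"
    by (simp only: coprime_int_iff)
  then have "int r ^ a dvd X"
    using dvd by (simp add: coprime_dvd_mult_right_iff)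
  then show ?thesis using \<open>X dvd Y\<close> by (rule dvd_trans)
qed

text \<open>
  The key estimate for \<open>q\<^sup>2\<close> in place of \<open>q\<close>.  Here \<open>r = 2\<close> needs no special treatment,
  since the square of an odd number is 1 modulo 4.
\<close>

lemma prime_power_le_even_degrees:
  fixes q r a b :: nat and X :: int
  assumes r: "prime r" "\<not> r dvd q" and q: "q \<ge> 2"
    and dvd: "int r ^ a dvd int q ^ b * X" "X dvd (\<Prod>i=1..m. int q ^ (2 * i) - 1)"
  shows "r ^ a \<le> q ^ (3 * m)"
proof -
  have "int r ^ a dvd (\<Prod>i=1..m. int (q\<^sup>2) ^ i - 1)"
    using prime_power_dvd_cofactor[OF r dvd] by (simp add: power_mult)
  moreover have "\<not> r dvd q\<^sup>2"
    using r by (simp add: prime_dvd_power_iff)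
  moreover have "4 dvd int (q\<^sup>2) - 1" if "r = 2"
  proof -
    have "odd q" using r that by simp
    then obtain c where "q = 2 * c + 1" by (elim oddE)
    then have "int (q\<^sup>2) - 1 = 4 * (int c ^ 2 + int c)"
      by (simp add: power2_eq_square algebra_simps)
    then show ?thesis by simp
  qed
  moreover have "q\<^sup>2 \<ge> 2" using q self_le_power[of q 2] by simp
  ultimately have "r ^ a \<le> (2 * q\<^sup>2) ^ m"
    using r by (intro prime_power_dvd_prod_le)
  also have "\<dots> \<le> (q * q\<^sup>2) ^ m"
    using q by (intro power_mono mult_mono) auto
  also have "\<dots> = q ^ (3 * m)"
    unfolding power_mult by (simp add: power3_eq_cube power2_eq_square mult.assoc)
  finally show ?thesis .
qed

text \<open>
  For \<open>r = 2\<close> the key estimate need not apply to \<open>q\<close> itself, and the weaker bound comes from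
  \<open>q ^ i - 1\<close> dividing \<open>q ^ (2 * i) - 1\<close>.
\<close>

lemma prime_power_le_all_degrees:
  fixes q r a b :: nat and X :: int
  assumes r: "prime r" "\<not> r dvd q" and q: "q \<ge> 2"
    and dvd: "int r ^ a dvd int q ^ b * X" "X dvd (\<Prod>i=1..m. int q ^ i - 1)"
  shows "r ^ a \<le> q ^ (2 * m * (if r = 2 then 2 else 1))"
proof (cases "r = 2")
  case True
  have "(\<Prod>i=1..m. int q ^ i - 1) dvd (\<Prod>i=1..m. int q ^ (2 * i) - 1)"
  proof (rule prod_dvd_prod)
    fix i
    have "int q ^ (2 * i) - 1 = (int q ^ i - 1) * (int q ^ i + 1)"
      by (simp add: algebra_simps power_mult power2_eq_square flip: power_mult_distrib power_add mult_2)
    then show "int q ^ i - 1 dvd int q ^ (2 * i) - 1" by simp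
  qed
  then have "r ^ a \<le> q ^ (3 * m)"
    by (intro prime_power_le_even_degrees[OF r q dvd(1)] dvd_trans[OF dvd(2)])
  also have "\<dots> \<le> q ^ (2 * m * 2)"
    using q by (intro power_increasing) auto
  finally show ?thesis using True by simp
next
  case False
  then have "r ^ a \<le> (2 * q) ^ m"
    using prime_power_dvd_cofactor[OF r dvd] r q by (intro prime_power_dvd_prod_le) auto
  also have "\<dots> \<le> (q * q) ^ m"
    using q by (intro power_mono mult_mono) auto
  also have "\<dots> = q ^ (2 * m)"
    unfolding power_mult by (simp add: power2_eq_square)
  finally show ?thesis using False by simp
qed

section \<open>Lower bounds for the orders\<close>

lemma power_minus_one_ge:
  fixes q :: int
  assumes "q \<ge> 2" "i > 0"
  shows "(q - 1) * q ^ (i - 1) \<le> q ^ i - 1"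
proof -
  have "q ^ (i - 1) \<ge> 1" using assms by simp
  moreover have "q ^ i = q * q ^ (i - 1)" using assms by (cases i) auto
  ultimately show ?thesis by (simp add: algebra_simps)
qed

lemma prod_power_minus_one_ge:
  fixes q :: int
  assumes q: "q \<ge> 2" and f: "\<And>i. i \<in> A \<Longrightarrow> f i > 0"
  shows "(q - 1) ^ card A * q ^ (\<Sum>i\<in>A. f i - 1) \<le> (\<Prod>i\<in>A. q ^ f i - 1)"
proof -
  have "(q - 1) ^ card A * q ^ (\<Sum>i\<in>A. f i - 1) = (\<Prod>i\<in>A. (q - 1) * q ^ (f i - 1))"
    by (simp add: prod.distrib power_sum)
  also have "\<dots> \<le> (\<Prod>i\<in>A. q ^ f i - 1)"
    using q by (intro prod_mono conjI power_minus_one_ge f) auto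
  finally show ?thesis .
qed

lemma order_ge_of_times_diag:
  fixes N :: nat and d X :: int
  assumes "d * int N = q ^ b * X" "0 < d" "d * q ^ t \<le> X" "(q::int) \<ge> 0"
  shows "q ^ (b + t) \<le> int N"
proof -
  have "d * q ^ (b + t) = q ^ b * (d * q ^ t)"
    by (simp add: power_add)
  also have "\<dots> \<le> d * int N"
    using assms by (simp add: mult_left_mono)
  finally show ?thesis using \<open>0 < d\<close> by simp
qed

section \<open>From exponents of \<open>q\<close> to the bound\<close>

text \<open>
  The number \<open>c\<close> is a lower bound for the logarithm \<open>k\<close> in the exponent; the values 1
  and 2 suffice below.
\<close>

lemma prime_power_le_order_powr:
  fixes q r a N l s t c :: nat and k :: int
  assumes q: "q \<ge> 2" and N: "q ^ t \<le> N" and R: "r ^ a \<le> q ^ s" and l: "l > 0"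
    and c: "int c \<le> k" and le: "s * l \<le> 2 * c * t"
  shows "real (r ^ a) \<le> real N powr (2 * real_of_int k / real l)"
proof -
  have "real (r ^ a) \<le> real (q ^ s)" using R by (simp only: of_nat_le_iff)
  also have "\<dots> = real q powr real s" using q by (simp add: powr_realpow)
  also have "\<dots> \<le> real q powr (real t * (2 * real_of_int k / real l))"
  proof (intro powr_mono)
    have "real (s * l) \<le> real (2 * c * t)" using le by (simp only: of_nat_le_iff)
    then have "real s * real l \<le> 2 * real c * real t" by simp
    also have "\<dots> \<le> 2 * real_of_int k * real t"
      using c by (intro mult_right_mono) auto
    finally show "real s \<le> real t * (2 * real_of_int k / real l)"
      using l by (simp add: field_simps)
  qed (use q in auto)
  also have "\<dots> = real (q ^ t) powr (2 * real_of_int k / real l)"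
    using q by (simp add: powr_powr flip: powr_realpow)
  also have "\<dots> \<le> real N powr (2 * real_of_int k / real l)"
  proof (intro powr_mono2)
    show "real (q ^ t) \<le> real N" using N by (simp only: of_nat_le_iff)
    show "0 \<le> 2 * real_of_int k / real l" using c by simp
  qed auto
  finally show ?thesis .
qed

lemma le_order_powr_small_rank:
  fixes N n l :: nat and k :: int
  assumes "n \<le> N" "N > 0" "l > 0" "l \<le> 2" "k \<ge> 1"
  shows "real n \<le> real N powr (2 * real_of_int k / real l)"
proof -
  have "real n \<le> real N powr 1" using assms by simp
  also have "\<dots> \<le> real N powr (2 * real_of_int k / real l)"
    using assms by (intro powr_mono) (auto simp: field_simps)
  finally show ?thesis .
qed
text \<open>
  Each factor \<open>q ^ f i - 1\<close> is at least \<open>(q - 1) * q ^ (f i - 1)\<close>; one of the factors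
  \<open>q - 1\<close> makes up for the division by \<open>d\<close>.
\<close>

lemma order_ge_of_degrees:
  fixes d q N b :: nat
  assumes eq: "int d * int N = int q ^ b * (\<Prod>i\<in>A. int q ^ f i - 1)"
    and d: "0 < d" "d \<le> q - 1" and A: "finite A" "A \<noteq> {}" and q: "q \<ge> 2"
    and f: "\<And>i. i \<in> A \<Longrightarrow> f i > 0"
  shows "q ^ (b + (\<Sum>i\<in>A. f i - 1)) \<le> N"
proof -
  have "int d \<le> int q - 1" using d q by linarith
  also have "\<dots> \<le> (int q - 1) ^ card A"
    using A q by (intro self_le_power) (auto simp: card_gt_0_iff)
  finally have "int d * int q ^ (\<Sum>i\<in>A. f i - 1) \<le> (\<Prod>i\<in>A. int q ^ f i - 1)"
    using q f by (intro order_trans[OF mult_right_mono prod_power_minus_one_ge]) auto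
  then have "int q ^ (b + (\<Sum>i\<in>A. f i - 1)) \<le> int N"
    using d eq by (intro order_ge_of_times_diag) auto
  then show ?thesis by (simp only: of_nat_power[symmetric] of_nat_le_iff)
qed

lemma sum_pred_eq_triangle: "(\<Sum>i=2..n + 1. i - 1) = n * (n + 1) div (2::nat)"
  by (induction n) auto

lemma sum_odd_eq_square: "(\<Sum>i=1..n. 2 * i - 1) = (n::nat)\<^sup>2"
  by (induction n) (auto simp: power2_eq_square)

lemma double_triangle: "n * (n + 1) div 2 + n * (n + 1) div 2 = n * (n + 1)" for n :: nat
proof -
  have "even (n * (n + 1))" by simp
  then show ?thesis by (elim evenE) simp
qed

text \<open>
  The factor \<open>q + 1\<close>, taken from \<open>q\<^sup>2 - 1\<close>, makes up for the division by
  \<open>gcd (n + 1) (q + 1)\<close> in the order of the unitary groups.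
\<close>

lemma prod_unitary_degrees_ge:
  fixes q :: int
  assumes q: "q \<ge> 2" and "n \<ge> 2"
  shows "(q + 1) * q ^ (n * (n + 1) div 2) \<le> (\<Prod>i=2..n + 1. q ^ i - (- 1) ^ i)"
  using \<open>n \<ge> 2\<close>
proof (induction n rule: nat_induct_at_least)
  case base
  have "(q + 1) * q ^ 3 \<le> (q ^ 2 - 1) * (q ^ 3 + 1)"
  proof -
    have "(q ^ 2 - 1) * (q ^ 3 + 1) = (q + 1) * ((q - 1) * (q ^ 3 + 1))"
      by (simp add: algebra_simps power2_eq_square)
    moreover have "1 * q ^ 3 \<le> (q - 1) * (q ^ 3 + 1)"
      using q by (intro mult_mono) auto
    moreover have "(q + 1) * (1 * q ^ 3) \<le> (q + 1) * ((q - 1) * (q ^ 3 + 1))"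
      using q calculation(2) by (intro mult_left_mono) auto
    ultimately show ?thesis by linarith
  qed
  moreover have "{2..2 + 1} = {2, 3::nat}" by auto
  ultimately show ?case by simp
next
  case (Suc n)
  have pos: "0 < q ^ k" for k using q by simp
  have "q ^ (n + 1) \<le> q ^ (n + 2) - (- 1) ^ (n + 2)"
  proof -
    have "2 * q ^ (n + 1) \<le> q * q ^ (n + 1)" using q by (intro mult_right_mono) auto
    moreover have "(- 1 :: int) ^ (n + 2) \<le> 1" by (cases "even n") auto
    ultimately show ?thesis using pos[of "n + 1"] by simp
  qed
  moreover have "0 \<le> (\<Prod>i=2..n + 1. q ^ i - (- 1) ^ i)"
    using q pos by (intro order_trans[OF _ Suc.IH]) auto
  ultimately have "((q + 1) * q ^ (n * (n + 1) div 2)) * q ^ (n + 1)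
      \<le> (\<Prod>i=2..n + 1. q ^ i - (- 1) ^ i) * (q ^ (n + 2) - (- 1) ^ (n + 2))"
    using q by (intro mult_mono Suc.IH) auto
  moreover have "Suc n * (Suc n + 1) div 2 = n * (n + 1) div 2 + (n + 1)"
    by simp
  moreover have "(\<Prod>i=2..Suc n + 1. q ^ i - (- 1) ^ i)
      = (\<Prod>i=2..n + 1. q ^ i - (- 1) ^ i) * (q ^ (n + 2) - (- 1) ^ (n + 2))"
  proof -
    have "{2..Suc n + 1} = insert (n + 2) {2..n + 1}" by auto
    then have "(\<Prod>i=2..Suc n + 1. q ^ i - (- 1) ^ i)
        = (q ^ (n + 2) - (- 1) ^ (n + 2)) * (\<Prod>i=2..n + 1. q ^ i - (- 1) ^ i)"
      by (simp only:) (rule prod.insert, auto)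
    then show ?thesis by (simp only: mult.commute)
  qed
  ultimately show ?case by (simp only: power_add mult.assoc)
qed

lemma gcd_4_le:
  fixes q m :: nat
  assumes "q \<ge> 2" and m: "even q \<Longrightarrow> odd m"
  shows "int (gcd 4 m) \<le> (int q - 1) ^ 2"
proof (cases "even q")
  case True
  then have "coprime (2 ^ 2) m" using m by (simp only: coprime_power_left_iff) simp
  then have "gcd 4 m = 1" by simp
  then show ?thesis using assms by simp
next
  case False
  then have "q \<noteq> 2" by auto
  with assms have "2 ^ 2 \<le> (int q - 1) ^ 2" by (intro power_mono) auto
  then have "4 \<le> (int q - 1) ^ 2" by simp
  moreover have "gcd 4 m \<le> 4" by (intro gcd_le1_nat) simp
  then have "int (gcd 4 m) \<le> 4" by linarith
  ultimately show ?thesis by (rule order_trans[rotated])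
qed

text \<open>
  Here \<open>E\<close> stands for \<open>q ^ n - 1\<close> or \<open>q ^ n + 1\<close> with \<open>n = Suc m\<close>.  As \<open>d\<close> may be 4 when
  \<open>q = 3\<close>, two factors \<open>q - 1\<close> are needed to make up for it.
\<close>

lemma order_ge_orthogonal_even:
  fixes d q N m :: nat and E :: int
  assumes eq: "int d * int N = int q ^ (Suc m * m) * (E * (\<Prod>i=1..m. int q ^ (2 * i) - 1))"
    and d: "0 < d" "int d \<le> (int q - 1) ^ 2" and E: "int q ^ Suc m - 1 \<le> E"
    and q: "q \<ge> 2" and m: "m \<ge> 1"
  shows "q ^ (2 * (Suc m * m)) \<le> N"
proof -
  define p where "p = int q - 1"
  have p: "p \<ge> 1" using q by (simp add: p_def)
  have "int d * int q ^ (Suc m * m) \<le> p ^ Suc m * int q ^ (m + m\<^sup>2)"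
  proof -
    have "p ^ 2 \<le> p ^ Suc m" using p m by (intro power_increasing) auto
    moreover have "Suc m * m = m + m\<^sup>2" by (simp add: power2_eq_square)
    ultimately show ?thesis
      using d by (auto intro: mult_right_mono simp: p_def)
  qed
  also have "\<dots> = (p * int q ^ m) * (p ^ m * int q ^ m\<^sup>2)"
    by (simp add: power_add)
  also have "\<dots> \<le> E * (\<Prod>i=1..m. int q ^ (2 * i) - 1)"
  proof (rule mult_mono)
    show *: "p * int q ^ m \<le> E"
      unfolding p_def using power_minus_one_ge[of "int q" "Suc m"] E q
      by (intro order_trans[OF _ E]) auto
    show "p ^ m * int q ^ m\<^sup>2 \<le> (\<Prod>i=1..m. int q ^ (2 * i) - 1)"
      using prod_power_minus_one_ge[of "int q" "{1..m}" "\<lambda>i. 2 * i"] q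
      unfolding sum_odd_eq_square by (simp add: p_def)
    show "0 \<le> E" using p by (intro order_trans[OF _ *]) auto
  qed (use p in auto)
  finally have "int q ^ (Suc m * m + Suc m * m) \<le> int N"
    using d eq by (intro order_ge_of_times_diag) auto
  then show ?thesis by (simp only: of_nat_power[symmetric] of_nat_le_iff mult_2)
qed

section \<open>The families\<close>

text \<open>
  \<open>N\<close> plays the role of the order of the group, \<open>r ^ a\<close> that of the order of its Sylow
  subgroup, and \<open>k\<close> that of the logarithm in the exponent, of which only the lower bounds
  below are used.
\<close>

locale cross_characteristic =
  fixes q r a N :: nat and k :: int
  assumes q: "q \<ge> 2" and r: "prime r" "\<not> r dvd q" and dvd: "r ^ a dvd N"
    and k: "k \<ge> 1" "r = 2 \<Longrightarrow> k \<ge> 2"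
begin

lemma dvd_order_formula:
  assumes "int d * int N = X"
  shows "int r ^ a dvd X"
proof -
  have "int (r ^ a) dvd int N" using dvd by (simp only: of_nat_dvd_iff)
  then have "int (r ^ a) dvd int d * int N" by (rule dvd_mult)
  then show ?thesis using assms by simp
qed

lemma diag_bounds: "0 < gcd n (q - 1)" "gcd n (q - 1) \<le> q - 1"
  using q by (auto intro: gcd_le2_nat)

lemma power_pos: "0 < int q ^ i"
  using q by simp

lemma power_minus_one_pos: "i > 0 \<Longrightarrow> 0 < int q ^ i - 1"
  using q one_less_power[of "int q" i] by simp

lemma bound_small_rank:
  assumes "int d * int N = X" "X > 0" "0 < l" "l \<le> 2"
  shows "real (r ^ a) \<le> real N powr (2 * real_of_int k / real l)"
proof -
  have "N > 0" using assms by (cases N) auto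
  moreover have "r ^ a \<le> N" using dvd \<open>N > 0\<close> by (rule dvd_imp_le)
  ultimately show ?thesis using assms k by (intro le_order_powr_small_rank)
qed

text \<open>
  Exponents of either parity are allowed here; applied to types A and \<open>E\<^sub>6\<close>.  The
  weaker bound for \<open>r = 2\<close> is compensated by \<open>k \<ge> 2\<close>.
\<close>

lemma bound_all_degrees:
  assumes eq: "int d * int N = int q ^ b * (\<Prod>i\<in>A. int q ^ i - 1)"
    and d: "0 < d" "d \<le> q - 1" and A: "A \<subseteq> {1..m}" "A \<noteq> {}"
    and l: "0 < l" "m * l \<le> b + (\<Sum>i\<in>A. i - 1)"
  shows "real (r ^ a) \<le> real N powr (2 * real_of_int k / real l)"
proof -
  define c :: nat where "c = (if r = 2 then 2 else 1)"
  have "finite A" using A by (auto intro: finite_subset)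
  then have "q ^ (b + (\<Sum>i\<in>A. i - 1)) \<le> N"
    using A by (intro order_ge_of_degrees[OF eq d _ _ q]) auto
  moreover have "r ^ a \<le> q ^ (2 * m * c)"
    unfolding c_def using A
    by (intro prime_power_le_all_degrees[OF r q dvd_order_formula[OF eq]] prod_dvd_prod_subset) auto
  moreover have "int c \<le> k" using k by (auto simp: c_def)
  moreover have "2 * m * c * l \<le> 2 * c * (b + (\<Sum>i\<in>A. i - 1))"
    using mult_le_mono2[OF l(2), of "2 * c"] by (simp only: ac_simps)
  ultimately show ?thesis
    using l(1) by (intro prime_power_le_order_powr[OF q])
qed

text \<open>
  Applied to types B, C, \<open>E\<^sub>7\<close>, \<open>E\<^sub>8\<close> and \<open>F\<^sub>4\<close>.
\<close>

lemma bound_even_degrees: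
  assumes eq: "int d * int N = int q ^ b * (\<Prod>i\<in>A. int q ^ (2 * i) - 1)"
    and d: "0 < d" "d \<le> q - 1" and A: "A \<subseteq> {1..m}" "A \<noteq> {}"
    and l: "0 < l" "3 * m * l \<le> 2 * (b + (\<Sum>i\<in>A. 2 * i - 1))"
  shows "real (r ^ a) \<le> real N powr (2 * real_of_int k / real l)"
proof -
  have "finite A" using A by (auto intro: finite_subset)
  then have "q ^ (b + (\<Sum>i\<in>A. 2 * i - 1)) \<le> N"
    using A by (intro order_ge_of_degrees[OF eq d _ _ q]) auto
  moreover have "r ^ a \<le> q ^ (3 * m)"
    using A
    by (intro prime_power_le_even_degrees[OF r q dvd_order_formula[OF eq]] prod_dvd_prod_subset) auto
  ultimately show ?thesis
    using l k by (intro prime_power_le_order_powr[OF q, where c = 1]) auto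
qed

lemma bound_linear:
  assumes eq: "int (gcd (n + 1) (q - 1)) * int N
      = int q ^ (n * (n + 1) div 2) * (\<Prod>i=2..n + 1. int q ^ i - 1)"
    and n: "n \<ge> 1"
  shows "real (r ^ a) \<le> real N powr (2 * real_of_int k / real n)"
proof (rule bound_all_degrees[OF eq diag_bounds])
  show "(n + 1) * n \<le> n * (n + 1) div 2 + (\<Sum>i=2..n + 1. i - 1)"
    unfolding sum_pred_eq_triangle double_triangle by (simp only: mult.commute)
qed (use n in auto)

text \<open>
  The inequality \<open>3 * l \<le> 2 * n\<close> needed to compare \<open>q ^ (3 * (n + 1))\<close> with
  \<open>q ^ (n * (n + 1))\<close> is used with \<open>l = (n + 1) div 2\<close> and \<open>n \<ge> 3\<close>; for \<open>n = 2\<close> the rank is 1 and the claim is trivial.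
\<close>

lemma bound_unitary:
  assumes eq: "int (gcd (n + 1) (q + 1)) * int N
      = int q ^ (n * (n + 1) div 2) * (\<Prod>i=2..n + 1. int q ^ i - (- 1) ^ i)"
    and n: "n \<ge> 2"
  shows "real (r ^ a) \<le> real N powr (2 * real_of_int k / real ((n + 1) div 2))"
proof -
  let ?X = "\<Prod>i=2..n + 1. int q ^ i - (- 1) ^ i"
  have X: "(int q + 1) * int q ^ (n * (n + 1) div 2) \<le> ?X"
    using q n by (intro prod_unitary_degrees_ge) auto
  have "gcd (n + 1) (q + 1) \<le> q + 1" by (intro gcd_le2_nat) simp
  then have d: "int (gcd (n + 1) (q + 1)) \<le> int q + 1" by linarith
  have "int q ^ (n * (n + 1) div 2 + n * (n + 1) div 2) \<le> int N"
  proof (rule order_ge_of_times_diag[OF eq])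
    show "int (gcd (n + 1) (q + 1)) * int q ^ (n * (n + 1) div 2) \<le> ?X"
      using d by (intro order_trans[OF mult_right_mono X]) auto
    have "gcd (n + 1) (q + 1) > 0" by simp
    then show "0 < int (gcd (n + 1) (q + 1))" by linarith
  qed simp
  then have N: "q ^ (n * (n + 1)) \<le> N"
    unfolding double_triangle by (simp only: of_nat_power[symmetric] of_nat_le_iff)
  show ?thesis
  proof (cases "n = 2")
    case True
    have "?X > 0" using X q by (intro less_le_trans[OF _ X]) auto
    then have "int q ^ (n * (n + 1) div 2) * ?X > 0" by (intro mult_pos_pos power_pos)
    then show ?thesis using True by (intro bound_small_rank[OF eq]) auto
  next
    case False
    have "?X dvd (\<Prod>i=1..n + 1. int q ^ (2 * i) - 1)"
    proof (rule prod_dvd_prod_subset2)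
      fix i :: nat
      have "int q ^ (2 * i) - 1 = (int q ^ i - (- 1) ^ i) * (int q ^ i + (- 1) ^ i)"
        unfolding power_even_eq by (cases "even i") (auto simp: algebra_simps power2_eq_square)
      then show "int q ^ i - (- 1) ^ i dvd int q ^ (2 * i) - 1" by simp
    qed auto
    then have R: "r ^ a \<le> q ^ (3 * (n + 1))"
      by (rule prime_power_le_even_degrees[OF r q dvd_order_formula[OF eq]])
    have "3 * ((n + 1) div 2) \<le> 2 * n" using False n by linarith
    then have "(n + 1) * (3 * ((n + 1) div 2)) \<le> (n + 1) * (2 * n)"
      by (rule mult_le_mono2)
    then have "3 * (n + 1) * ((n + 1) div 2) \<le> 2 * 1 * (n * (n + 1))"
      by (simp only: ac_simps mult_1)
    then show ?thesis
      using n k by (intro prime_power_le_order_powr[OF q N R, where c = 1]) auto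
  qed
qed

lemma bound_symplectic:
  assumes "int (gcd 2 (q - 1)) * int N = int q ^ (n ^ 2) * (\<Prod>i=1..n. int q ^ (2 * i) - 1)"
    and n: "n \<ge> 1"
  shows "real (r ^ a) \<le> real N powr (2 * real_of_int k / real n)"
proof (rule bound_even_degrees[OF assms(1) diag_bounds])
  show "3 * n * n \<le> 2 * (n\<^sup>2 + (\<Sum>i=1..n. 2 * i - 1))"
    unfolding sum_odd_eq_square by (simp add: power2_eq_square)
qed (use n in auto)

text \<open>
  Types D and \<open>\<^sup>2D\<close>, with \<open>e = -1\<close>, \<open>l = n\<close> and \<open>e = 1\<close>, \<open>l = n - 1\<close> respectively.  In
  both cases \<open>q ^ n + e\<close> divides \<open>q ^ (2 * n) - 1\<close>.
\<close>

lemma bound_orthogonal_even: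
  fixes e :: int
  assumes eq: "int (gcd 4 D) * int N
      = int q ^ (n * (n - 1)) * (int q ^ n + e) * (\<Prod>i=1..n - 1. int q ^ (2 * i) - 1)"
    and e: "e\<^sup>2 = 1" and D: "even q \<Longrightarrow> odd D" and n: "n \<ge> 4" and l: "0 < l" "l \<le> n"
  shows "real (r ^ a) \<le> real N powr (2 * real_of_int k / real l)"
proof -
  obtain m where m: "n = Suc m" "m \<ge> 3" using n by (cases n) auto
  have e': "e = 1 \<or> e = - 1" using e by (simp add: power2_eq_1_iff)
  let ?X = "(int q ^ n + e) * (\<Prod>i=1..m. int q ^ (2 * i) - 1)"
  have eq': "int (gcd 4 D) * int N = int q ^ (n * m) * ?X"
    using eq by (simp add: m mult.assoc)
  have N: "q ^ (2 * (n * m)) \<le> N"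
    unfolding m(1)
  proof (rule order_ge_orthogonal_even[OF eq'[unfolded m(1)]])
    show "int (gcd 4 D) \<le> (int q - 1)\<^sup>2" using q D by (rule gcd_4_le)
    show "int q ^ Suc m - 1 \<le> int q ^ Suc m + e" using e' by auto
  qed (use q m in auto)
  have "int q ^ (2 * n) - 1 = (int q ^ n + e) * (int q ^ n - e)"
    using e unfolding power_even_eq by (simp add: algebra_simps power2_eq_square)
  then have "?X dvd (\<Prod>i=1..n. int q ^ (2 * i) - 1)"
    by (simp add: m mult.commute mult_dvd_mono)
  then have R: "r ^ a \<le> q ^ (3 * n)"
    by (rule prime_power_le_even_degrees[OF r q dvd_order_formula[OF eq']])
  have "3 * n * l \<le> 3 * n * n" using l by simp
  also have "\<dots> = n * (3 * n)" by simp
  also have "\<dots> \<le> n * (4 * m)" using m by (intro mult_le_mono2) auto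
  finally have "3 * n * l \<le> 2 * 1 * (2 * (n * m))" by simp
  then show ?thesis
    using l k by (intro prime_power_le_order_powr[OF q N R, where c = 1]) auto
qed

text \<open>
  The factors \<open>q ^ 9 + 1\<close> and \<open>q ^ 5 + 1\<close> divide \<open>q ^ 18 - 1\<close> and \<open>q ^ 10 - 1\<close>, so
  \<open>r ^ a\<close> is bounded as for the exponents 2, 6, 8, 10, 12 and 18; the factor \<open>q\<^sup>2 - 1\<close>
  makes up for the division by \<open>gcd 3 (q + 1)\<close>.
\<close>

lemma bound_2E6:
  assumes eq: "int (gcd 3 (q + 1)) * int N = lie_order_times_diag Lie_2E6 (int q)"
  shows "real (r ^ a) \<le> real N powr (2 * real_of_int k / real 4)"
proof -
  let ?X = "(int q ^ 12 - 1) * (int q ^ 9 + 1) * (int q ^ 8 - 1) * (int q ^ 6 - 1)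
    * (int q ^ 5 + 1) * (int q ^ 2 - 1)"
  have eq': "int (gcd 3 (q + 1)) * int N = int q ^ 36 * ?X"
    using eq by (simp only: lie_order_times_diag.simps mult.assoc)
  have ge: "int q ^ (i - 1) \<le> int q ^ i - 1" if "i > 0" for i
  proof -
    have "1 * int q ^ (i - 1) \<le> (int q - 1) * int q ^ (i - 1)"
      using q by (intro mult_right_mono) auto
    also have "\<dots> \<le> int q ^ i - 1" using q that by (intro power_minus_one_ge) auto
    finally show ?thesis by simp
  qed
  have "gcd 3 (q + 1) \<le> q + 1" by (intro gcd_le2_nat) simp
  then have "int (gcd 3 (q + 1)) \<le> int q + 1" by linarith
  also have "\<dots> = (int q + 1) * 1" by simp
  also have "\<dots> \<le> (int q + 1) * (int q - 1)" using q by (intro mult_left_mono) auto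
  also have "\<dots> = int q ^ 2 - 1" by (simp add: algebra_simps power2_eq_square)
  finally have d: "int (gcd 3 (q + 1)) \<le> int q ^ 2 - 1" .
  have "int q ^ (36 + 36) \<le> int N"
  proof (rule order_ge_of_times_diag[OF eq'])
    have "int q ^ 11 * int q ^ 8 * int q ^ 7 * int q ^ 5 * int q ^ 5 * int (gcd 3 (q + 1)) \<le> ?X"
    proof (intro mult_mono d)
      show "int q ^ 11 \<le> int q ^ 12 - 1" "int q ^ 7 \<le> int q ^ 8 - 1" "int q ^ 5 \<le> int q ^ 6 - 1"
        using ge[of 12] ge[of 8] ge[of 6] by simp_all
      show "int q ^ 8 \<le> int q ^ 9 + 1"
        using ge[of 9] by simp
    qed (use q power_minus_one_pos[of 12] power_minus_one_pos[of 8] power_minus_one_pos[of 6] in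
        \<open>simp_all add: less_imp_le\<close>)
    then show "int (gcd 3 (q + 1)) * int q ^ 36 \<le> ?X"
      by (simp add: mult.commute flip: power_add)
    have "gcd 3 (q + 1) > 0" by simp
    then show "0 < int (gcd 3 (q + 1))" by linarith
  qed simp
  then have N: "q ^ 72 \<le> N" by (simp flip: of_nat_power)
  have sq: "int q ^ (2 * i) - 1 = (int q ^ i + 1) * (int q ^ i - 1)" for i
    unfolding power_even_eq by (simp add: algebra_simps power2_eq_square)
  have "?X dvd (\<Prod>i\<in>{6, 9, 4, 3, 5, 1}. int q ^ (2 * i) - 1)"
    using sq[of 9] sq[of 5] by (simp add: mult.assoc mult_dvd_mono)
  also have "\<dots> dvd (\<Prod>i=1..9. int q ^ (2 * i) - 1)"
    by (intro prod_dvd_prod_subset) auto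
  finally have "r ^ a \<le> q ^ (3 * 9)"
    by (rule prime_power_le_even_degrees[OF r q dvd_order_formula[OF eq']])
  then show ?thesis
    using k by (intro prime_power_le_order_powr[OF q N, where c = 1]) auto
qed

lemma bound_lie_type:
  assumes F: "family_condition F q"
    and eq: "int (lie_diag F q) * int N = lie_order_times_diag F (int q)"
  shows "real (r ^ a) \<le> real N powr (2 * real_of_int k / real (lie_rank F))"
proof -
  note pos = power_minus_one_pos
  have pos': "0 < int q ^ i + 1" for i using q by (simp add: add_pos_pos)
  show ?thesis
  proof (cases F)
    case (Lie_A n)
    then show ?thesis using bound_linear[of n] F eq by auto
  next
    case (Lie_2A n)
    then show ?thesis using bound_unitary[of n] F eq by auto
  next
    case (Lie_B n)
    then show ?thesis using bound_symplectic[of n] F eq by auto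
  next
    case (Lie_C n)
    then show ?thesis using bound_symplectic[of n] F eq by auto
  next
    case (Lie_D n)
    have "real (r ^ a) \<le> real N powr (2 * real_of_int k / real n)"
      by (rule bound_orthogonal_even[of "q ^ n - 1" n "- 1"]) (use Lie_D F eq q in auto)
    then show ?thesis by (simp add: Lie_D)
  next
    case (Lie_2D n)
    have "real (r ^ a) \<le> real N powr (2 * real_of_int k / real (n - 1))"
      by (rule bound_orthogonal_even[of "q ^ n + 1" n 1]) (use Lie_2D F eq q in auto)
    then show ?thesis by (simp add: Lie_2D)
  next
    case Lie_2B2
    have "lie_order_times_diag F (int q) > 0"
      using Lie_2B2 pos'[of 2] pos[of 1] power_pos[of 2] by simp
    then show ?thesis using eq by (intro bound_small_rank) (auto simp: Lie_2B2)
  next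
    case Lie_3D4
    have "0 < int q ^ 8 + int q ^ 4 + 1" by (intro add_pos_pos power_pos) simp
    then have "lie_order_times_diag F (int q) > 0"
      using Lie_3D4 pos[of 6] pos[of 2] power_pos[of 12] by simp
    then show ?thesis using eq by (intro bound_small_rank) (auto simp: Lie_3D4)
  next
    case Lie_E6
    let ?A = "{2, 5, 6, 8, 9, 12} :: nat set"
    have "real (r ^ a) \<le> real N powr (2 * real_of_int k / real 6)"
      using eq by (intro bound_all_degrees[of "gcd 3 (q - 1)" 36 ?A 12] diag_bounds)
        (auto simp: Lie_E6)
    then show ?thesis by (simp add: Lie_E6)
  next
    case Lie_2E6
    then show ?thesis using bound_2E6 eq by simp
  next
    case Lie_E7
    let ?A = "{1, 3, 4, 5, 6, 7, 9} :: nat set"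
    have "real (r ^ a) \<le> real N powr (2 * real_of_int k / real 7)"
      using eq by (intro bound_even_degrees[of "gcd 2 (q - 1)" 63 ?A 9] diag_bounds)
        (auto simp: Lie_E7)
    then show ?thesis by (simp add: Lie_E7)
  next
    case Lie_E8
    let ?A = "{1, 4, 6, 7, 9, 10, 12, 15} :: nat set"
    have "real (r ^ a) \<le> real N powr (2 * real_of_int k / real 8)"
      using eq q by (intro bound_even_degrees[of 1 120 ?A 15]) (auto simp: Lie_E8)
    then show ?thesis by (simp add: Lie_E8)
  next
    case Lie_F4
    let ?A = "{1, 3, 4, 6} :: nat set"
    have "real (r ^ a) \<le> real N powr (2 * real_of_int k / real 4)"
      using eq q by (intro bound_even_degrees[of 1 24 ?A 6]) (auto simp: Lie_F4)
    then show ?thesis by (simp add: Lie_F4)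
  next
    case Lie_2F4
    have "lie_order_times_diag F (int q) > 0"
    proof (cases "q = 2")
      case False
      then show ?thesis
        using Lie_2F4 pos'[of 6] pos[of 4] pos'[of 3] pos[of 1] power_pos[of 12]
        by (simp add: Let_def)
    qed (simp add: Lie_2F4)
    then show ?thesis using eq by (intro bound_small_rank) (auto simp: Lie_2F4)
  next
    case Lie_G2
    have "lie_order_times_diag F (int q) > 0"
      using Lie_G2 pos[of 6] pos[of 2] power_pos[of 6] by simp
    then show ?thesis using eq by (intro bound_small_rank) (auto simp: Lie_G2)
  next
    case Lie_2G2
    have "lie_order_times_diag F (int q) > 0"
      using Lie_2G2 pos'[of 3] pos[of 1] power_pos[of 3] by simp
    then show ?thesis using eq by (intro bound_small_rank) (auto simp: Lie_2G2)
  qed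
qed

end

theorem mainTheorem2:
  fixes T :: "'a monoid" and R :: "'a set" and F :: lie_family and q r :: nat
  assumes "primepow q"
    and "family_condition F q"
    and "simple_group T"
    and "lie_type_group TYPE('k::{field,finite}) F q T"
    and "int (lie_diag F q) * int (Coset.order T) = lie_order_times_diag F (int q)"
    and "prime r"
    and "r dvd Coset.order T"
    and "\<not> r dvd q"
    and "sylow_subgroup r R T"
  shows "real (card R) \<le> real (Coset.order T) powr
    (2 * real_of_int \<lfloor>log (real r) (4 * (real (lie_rank F) + 1) * real r)\<rfloor> / real (lie_rank F))"
proof -
  let ?y = "4 * (real (lie_rank F) + 1) * real r"
  have r: "real r > 1" using prime_gt_1_nat[OF \<open>prime r\<close>] by simp
  have y: "4 * real r \<le> ?y" using r by (intro mult_right_mono) auto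
  \<comment> \<open>Since \<open>?y\<close> is at least \<open>4 * r\<close>, the logarithm is at least 1, and at least 2 if \<open>r = 2\<close>.\<close>
  have k: "int j \<le> \<lfloor>log (real r) ?y\<rfloor>" if "real r ^ j \<le> ?y" for j
    using that r y by (simp add: le_floor_iff le_log_iff powr_realpow)
  have k1: "1 \<le> \<lfloor>log (real r) ?y\<rfloor>"
    using k[of 1] y r by simp
  have k2: "2 \<le> \<lfloor>log (real r) ?y\<rfloor>" if "r = 2"
    using k[of 2] that by simp
  have card: "card R = r ^ multiplicity r (Coset.order T)"
    using assms(9) by (simp add: sylow_subgroup_def)
  have "q \<ge> 2" using primepow_gt_Suc_0[OF assms(1)] by simp
  then interpret cross_characteristic q r "multiplicity r (Coset.order T)" "Coset.order T"
      "\<lfloor>log (real r) ?y\<rfloor>"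
    using assms k1 k2 by unfold_locales (auto simp: multiplicity_dvd)
  show ?thesis
    using bound_lie_type[OF assms(2,5)] card by simp
qed

end
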